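(* Let $M$ be a finite LTS, $B\subseteq\mathit{Act}$, $\rho$ a regular formula, $\alpha_f,\alpha_e\subseteq\mathit{Act}$. $M$ satisfies $$\neg\langle\rho\cdot\overline{\alpha_f}^{\,*}\rangle\Big(\langle\alpha_e\rangle\mathit{tt}\lor[\overline{B}]\mathit{ff}\lor\bigvee_{\emptyset\neq F\subseteq\overline{B}}\nu X.\Big(\bigwedge_{a\in F}\mu W.\Big(\big(\bigwedge_{b\in\overline{B}\setminus F}[b]\mathit{ff}\big)\land\big(\langle\{a\}\setminus\alpha_f\rangle X\lor\langle\overline{\alpha_f}\rangle W\big)\Big)\Big)\Big)$$ if, and only if, its initial state does not admit any path that is $B$-progressing, satisfies $B$-strong fairness of actions, and is $(\rho,\alpha_f,\alpha_e)$-violating.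
   Context: LTS $M=(S,s_{init},\mathit{Act},\mathit{Trans})$ with $S,\mathit{Act}$ finite; $M$ satisfies a closed formula if $s_{init}$ does. Paths: alternating sequences $s_0t_1s_1\dots$ starting in a state, infinite or ending in a state, consecutive. An action occurs on a path if a transition on it carries that label; $\alpha$-free = no action of $\alpha$ occurs. An action is enabled in $s$ if a transition with that label leaves $s$; it is relentlessly enabled on a path if every suffix contains a state in which it is enabled. $\overline{\alpha}=\mathit{Act}\setminus\alpha$. A state is $B$-locked if all actions enabled in it are in $B$; a path is $B$-progressing if infinite or ending in a $B$-locked state. A path $\pi$ satisfies $B$-strong fairness of actions iff for every suffix $\pi'$ of $\pi$, every $a\in\overline{B}$ relentlessly enabled in $\pi'$ occurs in $\pi'$. Regular formulae $R::=\varepsilon\mid\alpha\mid R\cdot Q\mid R+Q\mid R^*$; a finite path matches $R$ if its label sequence lies in the language of $R$. A path $\pi$ is $(\rho,\alpha_f,\alpha_e)$-violating if $\pi=\pi_{pre}\cdot\pi_{suf}$ with $\pi_{pre}$ finite matching $\rho$ and $\pi_{suf}$ either $\alpha_f$-free, or containing an action of $\alpha_e$ with the prefix before its first such occurrence $\alpha_f$-free. Modal $\mu$-calculus with standard semantics and abbreviations: $\mathit{tt}$, $\land$, $[R]\phi=\neg\langle R\rangle\neg\phi$, $\nu$ greatest fixpoint, single action denotes its singleton, $\langle\alpha\rangle\phi=\bigvee_{b\in\alpha}\langle b\rangle\phi$, $\langle R\cdot Q\rangle\phi=\langle R\rangle\langle Q\rangle\phi$, $\langle R+Q\rangle\phi=\langle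 R\rangle\phi\lor\langle Q\rangle\phi$, $\langle R^*\rangle\phi=\mu Y.(\langle R\rangle Y\lor\phi)$, $\langle\varepsilon\rangle\phi=\phi$. *)

theory Defs
  imports Main "HOL-Library.Stream"
begin

type_synonym ('s, 'a) transition = "'s \<times> 'a \<times> 's"

definition lab :: "('s, 'a) transition \<Rightarrow> 'a" where
  "lab t = fst (snd t)"

definition tgt :: "('s, 'a) transition \<Rightarrow> 's" where
  "tgt t = snd (snd t)"

record ('s, 'a) lts =
  states :: "'s set"
  initial :: 's
  acts :: "'a set"
  transitions :: "('s, 'a) transition set"

definition finite_lts :: "('s, 'a) lts \<Rightarrow> bool" where
  "finite_lts M \<longleftrightarrow> finite (states M) \<and> finite (acts M) \<and> initial M \<in> states M \<and>
     transitions M \<subseteq> states M \<times> acts M \<times> states M"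


text \<open>
  A path is given by its first state and its sequence of transitions. The remaining states of
  the alternating sequence are the targets of the transitions.
\<close>

datatype ('s, 'a) path =
    Fin 's "('s, 'a) transition list"
  | Inf 's "('s, 'a) transition stream"

fun walk :: "('s, 'a) lts \<Rightarrow> 's \<Rightarrow> ('s, 'a) transition list \<Rightarrow> bool" where
  "walk M s [] \<longleftrightarrow> s \<in> states M"
| "walk M s ((s1, a, s2) # ts) \<longleftrightarrow> s1 = s \<and> (s1, a, s2) \<in> transitions M \<and> walk M s2 ts"

fun is_path :: "('s, 'a) lts \<Rightarrow> ('s, 'a) path \<Rightarrow> bool" where
  "is_path M (Fin s ts) \<longleftrightarrow> walk M s ts"
| "is_path M (Inf s ts) \<longleftrightarrow> (\<forall>n. walk M s (stake n ts))"

fun first :: "('s, 'a) path \<Rightarrow> 's" where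
  "first (Fin s ts) = s"
| "first (Inf s ts) = s"

fun ends_in :: "('s, 'a) path \<Rightarrow> 's \<Rightarrow> bool" where
  "ends_in (Fin s ts) s' \<longleftrightarrow> s' = last (s # map tgt ts)"
| "ends_in (Inf s ts) s' \<longleftrightarrow> False"

fun infinite_path :: "('s, 'a) path \<Rightarrow> bool" where
  "infinite_path (Fin s ts) \<longleftrightarrow> False"
| "infinite_path (Inf s ts) \<longleftrightarrow> True"

fun path_states :: "('s, 'a) path \<Rightarrow> 's set" where
  "path_states (Fin s ts) = insert s (tgt ` set ts)"
| "path_states (Inf s ts) = insert s (tgt ` sset ts)"

fun occurring :: "('s, 'a) path \<Rightarrow> 'a set" where
  "occurring (Fin s ts) = lab ` set ts"
| "occurring (Inf s ts) = lab ` sset ts"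

definition free_of :: "'a set \<Rightarrow> ('s, 'a) path \<Rightarrow> bool" where
  "free_of \<alpha> \<pi> \<longleftrightarrow> occurring \<pi> \<inter> \<alpha> = {}"

text \<open>
  Concatenation is only meaningful if the first path is finite and ends where the second one
  starts; \<open>is_concat \<pi> \<pi>1 \<pi>2\<close> includes this condition.
\<close>

fun pappend :: "('s, 'a) path \<Rightarrow> ('s, 'a) path \<Rightarrow> ('s, 'a) path" where
  "pappend (Fin s ts) (Fin s' ts') = Fin s (ts @ ts')"
| "pappend (Fin s ts) (Inf s' ts') = Inf s (ts @- ts')"
| "pappend (Inf s ts) \<pi> = Inf s ts"

definition is_concat :: "('s, 'a) path \<Rightarrow> ('s, 'a) path \<Rightarrow> ('s, 'a) path \<Rightarrow> bool" where
  "is_concat \<pi> \<pi>1 \<pi>2 \<longleftrightarrow> ends_in \<pi>1 (first \<pi>2) \<and> \<pi> = pappend \<pi>1 \<pi>2"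

definition is_suffix :: "('s, 'a) path \<Rightarrow> ('s, 'a) path \<Rightarrow> bool" where
  "is_suffix \<pi>' \<pi> \<longleftrightarrow> (\<exists>\<pi>0. is_concat \<pi> \<pi>0 \<pi>')"

definition enabled :: "('s, 'a) lts \<Rightarrow> 'a \<Rightarrow> 's \<Rightarrow> bool" where
  "enabled M a s \<longleftrightarrow> (\<exists>s'. (s, a, s') \<in> transitions M)"

definition relentlessly_enabled :: "('s, 'a) lts \<Rightarrow> 'a \<Rightarrow> ('s, 'a) path \<Rightarrow> bool" where
  "relentlessly_enabled M a \<pi> \<longleftrightarrow>
     (\<forall>\<pi>'. is_suffix \<pi>' \<pi> \<longrightarrow> (\<exists>s \<in> path_states \<pi>'. enabled M a s))"

definition locked :: "('s, 'a) lts \<Rightarrow> 'a set \<Rightarrow> 's \<Rightarrow> bool" where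
  "locked M B s \<longleftrightarrow> (\<forall>a. enabled M a s \<longrightarrow> a \<in> B)"

definition progressing :: "('s, 'a) lts \<Rightarrow> 'a set \<Rightarrow> ('s, 'a) path \<Rightarrow> bool" where
  "progressing M B \<pi> \<longleftrightarrow> infinite_path \<pi> \<or> (\<exists>s. ends_in \<pi> s \<and> locked M B s)"

definition strongly_fair :: "('s, 'a) lts \<Rightarrow> 'a set \<Rightarrow> ('s, 'a) path \<Rightarrow> bool" where
  "strongly_fair M B \<pi> \<longleftrightarrow>
     (\<forall>\<pi>'. is_suffix \<pi>' \<pi> \<longrightarrow>
        (\<forall>a \<in> acts M - B. relentlessly_enabled M a \<pi>' \<longrightarrow> a \<in> occurring \<pi>'))"


datatype 'a regular =
    Eps
  | Acts "'a set"
  | Seq "'a regular" "'a regular"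
  | Alt "'a regular" "'a regular"
  | Star "'a regular"

fun regular_acts :: "'a regular \<Rightarrow> 'a set" where
  "regular_acts Eps = {}"
| "regular_acts (Acts \<alpha>) = \<alpha>"
| "regular_acts (Seq R Q) = regular_acts R \<union> regular_acts Q"
| "regular_acts (Alt R Q) = regular_acts R \<union> regular_acts Q"
| "regular_acts (Star R) = regular_acts R"

fun lang :: "'a regular \<Rightarrow> 'a list set" where
  "lang Eps = {[]}"
| "lang (Acts \<alpha>) = {[a] | a. a \<in> \<alpha>}"
| "lang (Seq R Q) = {u @ v | u v. u \<in> lang R \<and> v \<in> lang Q}"
| "lang (Alt R Q) = lang R \<union> lang Q"
| "lang (Star R) = {concat us | us. set us \<subseteq> lang R}"

fun matches :: "('s, 'a) path \<Rightarrow> 'a regular \<Rightarrow> bool" where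
  "matches (Fin s ts) R \<longleftrightarrow> map lab ts \<in> lang R"
| "matches (Inf s ts) R \<longleftrightarrow> False"

text \<open>
  In the second disjunct, \<open>\<pi>1\<close> is the part of \<open>\<pi>suf\<close> before the first occurrence of an action of
  \<open>\<alpha>e\<close>, and \<open>(s, e, s')\<close> is the transition carrying that occurrence.
\<close>

definition violating ::
  "'a regular \<Rightarrow> 'a set \<Rightarrow> 'a set \<Rightarrow> ('s, 'a) path \<Rightarrow> bool" where
  "violating \<rho> \<alpha>f \<alpha>e \<pi> \<longleftrightarrow>
     (\<exists>\<pi>pre \<pi>suf. is_concat \<pi> \<pi>pre \<pi>suf \<and> matches \<pi>pre \<rho> \<and>
        (free_of \<alpha>f \<pi>suf \<or>
         (\<exists>\<pi>1 \<pi>2 s e s' \<pi>3. is_concat \<pi>suf \<pi>1 \<pi>2 \<and> is_concat \<pi>2 (Fin s [(s, e, s')]) \<pi>3 \<and>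
            e \<in> \<alpha>e \<and> free_of \<alpha>e \<pi>1 \<and> free_of \<alpha>f \<pi>1)))"


datatype 'a fm =
    FF
  | Var nat
  | Neg "'a fm"
  | Or "'a fm" "'a fm"
  | Dia1 'a "'a fm"
  | Mu nat "'a fm"

text \<open>
  The semantics is defined for all formulae; the requirement that a variable bound by \<open>Mu\<close>
  occurs under an even number of negations is not part of the syntax. Where it holds, \<open>Mu\<close>
  denotes the least fixpoint.
\<close>

fun sem :: "('s, 'a) lts \<Rightarrow> (nat \<Rightarrow> 's set) \<Rightarrow> 'a fm \<Rightarrow> 's set" where
  "sem M e FF = {}"
| "sem M e (Var x) = e x"
| "sem M e (Neg \<phi>) = states M - sem M e \<phi>"
| "sem M e (Or \<phi> \<psi>) = sem M e \<phi> \<union> sem M e \<psi>"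
| "sem M e (Dia1 a \<phi>) = {s \<in> states M. \<exists>s'. (s, a, s') \<in> transitions M \<and> s' \<in> sem M e \<phi>}"
| "sem M e (Mu x \<phi>) = \<Inter> {U. U \<subseteq> states M \<and> sem M (e(x := U)) \<phi> \<subseteq> U}"

text \<open>Meant for closed formulae, for which the choice of environment is irrelevant.\<close>

definition satisfies :: "('s, 'a) lts \<Rightarrow> 'a fm \<Rightarrow> bool" (infix "satisfies" 50) where
  "M satisfies \<phi> \<longleftrightarrow> initial M \<in> sem M (\<lambda>_. {}) \<phi>"

definition TT :: "'a fm" where
  "TT = Neg FF"

definition And :: "'a fm \<Rightarrow> 'a fm \<Rightarrow> 'a fm" where
  "And \<phi> \<psi> = Neg (Or (Neg \<phi>) (Neg \<psi>))"

text \<open>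
  Disjunctions and conjunctions indexed by a finite set use an arbitrary enumeration of that
  set; they are unspecified for infinite sets.
\<close>

definition enumeration :: "'b set \<Rightarrow> 'b list" where
  "enumeration A = (SOME xs. set xs = A \<and> distinct xs)"

definition BigOr :: "'b set \<Rightarrow> ('b \<Rightarrow> 'a fm) \<Rightarrow> 'a fm" where
  "BigOr A f = foldr (\<lambda>x. Or (f x)) (enumeration A) FF"

definition BigAnd :: "'b set \<Rightarrow> ('b \<Rightarrow> 'a fm) \<Rightarrow> 'a fm" where
  "BigAnd A f = foldr (\<lambda>x. And (f x)) (enumeration A) TT"

text \<open>
  \<open>neg_var x \<phi>\<close> substitutes \<open>Neg (Var x)\<close> for the free occurrences of \<open>Var x\<close>, so that \<open>Nu\<close> is the
  usual dual of \<open>Mu\<close>. No binder for another variable can capture \<open>x\<close>.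
\<close>

fun neg_var :: "nat \<Rightarrow> 'a fm \<Rightarrow> 'a fm" where
  "neg_var x FF = FF"
| "neg_var x (Var y) = (if y = x then Neg (Var x) else Var y)"
| "neg_var x (Neg \<phi>) = Neg (neg_var x \<phi>)"
| "neg_var x (Or \<phi> \<psi>) = Or (neg_var x \<phi>) (neg_var x \<psi>)"
| "neg_var x (Dia1 a \<phi>) = Dia1 a (neg_var x \<phi>)"
| "neg_var x (Mu y \<phi>) = (if y = x then Mu y \<phi> else Mu y (neg_var x \<phi>))"

definition Nu :: "nat \<Rightarrow> 'a fm \<Rightarrow> 'a fm" where
  "Nu x \<phi> = Neg (Mu x (Neg (neg_var x \<phi>)))"

fun free_vars :: "'a fm \<Rightarrow> nat set" where
  "free_vars FF = {}"
| "free_vars (Var x) = {x}"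
| "free_vars (Neg \<phi>) = free_vars \<phi>"
| "free_vars (Or \<phi> \<psi>) = free_vars \<phi> \<union> free_vars \<psi>"
| "free_vars (Dia1 a \<phi>) = free_vars \<phi>"
| "free_vars (Mu x \<phi>) = free_vars \<phi> - {x}"

definition fresh :: "'a fm \<Rightarrow> nat" where
  "fresh \<phi> = (LEAST y. y \<notin> free_vars \<phi>)"

fun Dia :: "'a regular \<Rightarrow> 'a fm \<Rightarrow> 'a fm" where
  "Dia Eps \<phi> = \<phi>"
| "Dia (Acts \<alpha>) \<phi> = BigOr \<alpha> (\<lambda>b. Dia1 b \<phi>)"
| "Dia (Seq R Q) \<phi> = Dia R (Dia Q \<phi>)"
| "Dia (Alt R Q) \<phi> = Or (Dia R \<phi>) (Dia Q \<phi>)"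
| "Dia (Star R) \<phi> = Mu (fresh \<phi>) (Or (Dia R (Var (fresh \<phi>))) \<phi>)"

definition Box :: "'a regular \<Rightarrow> 'a fm \<Rightarrow> 'a fm" where
  "Box R \<phi> = Neg (Dia R (Neg \<phi>))"

end

theory Submission
  imports Defs
begin

text \<open>
  A state satisfies the greatest fixpoint for \<open>F\<close> iff it lies in a set \<open>V\<close> of states from each of
  which every \<open>a \<in> F\<close> can be executed by an \<open>\<alpha>f\<close>-free walk that ends in \<open>V\<close> and only leaves states
  where the actions of \<open>acts M - B - F\<close> are disabled. Serving the actions of \<open>F\<close> in turn gives an
  infinite fair \<open>\<alpha>f\<close>-free path. Conversely, on an infinite fair \<open>\<alpha>f\<close>-free path let \<open>F\<close> be the set of
  actions outside \<open>B\<close> that occur infinitely often. By fairness and finiteness every other action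
  outside \<open>B\<close> is disabled from some position on; the states after it form such a \<open>V\<close>, or, if \<open>F\<close> is
  empty, are \<open>B\<close>-locked. For the disjunct \<open>\<langle>\<alpha>e\<rangle>tt\<close> the path has to be continued fairly after the
  event: go to a locked state or to a bottom strongly connected component and serve there in turn
  all actions outside \<open>B\<close> that are enabled in it.
\<close>

section \<open>Walks\<close>

definition endpoint :: "'s \<Rightarrow> ('s, 'a) transition list \<Rightarrow> 's" where
  "endpoint s ts = last (s # map tgt ts)"

lemma endpoint_Nil [simp]: "endpoint s [] = s"
  by (simp add: endpoint_def)

lemma endpoint_Cons [simp]: "endpoint s (t # ts) = endpoint (tgt t) ts"
  by (simp add: endpoint_def)

lemma endpoint_append [simp]: "endpoint s (us @ vs) = endpoint (endpoint s us) vs"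
  by (induction us arbitrary: s) auto

lemma ends_in_Fin [simp]: "ends_in (Fin s ts) s' \<longleftrightarrow> s' = endpoint s ts"
  by (simp add: endpoint_def)

declare ends_in.simps(1) [simp del]

text \<open>Projections in place of the tuple pattern let the simplifier unfold a walk whose first
  transition is a variable; this equation replaces the defining one.\<close>

lemma walk_Cons [simp]:
  "walk M s (t # ts) \<longleftrightarrow> fst t = s \<and> t \<in> transitions M \<and> walk M (tgt t) ts"
  by (cases t) (auto simp: tgt_def)

declare walk.simps(2) [simp del]

lemma finite_lts_trans:
  assumes "finite_lts M" "t \<in> transitions M"
  shows "fst t \<in> states M" "lab t \<in> acts M" "tgt t \<in> states M"
  using assms by (auto simp: finite_lts_def lab_def tgt_def)

lemma finite_lts_step:
  assumes "finite_lts M" "(s, a, s') \<in> transitions M"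
  shows "s \<in> states M" "a \<in> acts M" "s' \<in> states M"
  using assms by (auto simp: finite_lts_def)

lemma walk_states:
  assumes "finite_lts M" "walk M s ts"
  shows "s \<in> states M" "endpoint s ts \<in> states M"
  using assms by (induction ts arbitrary: s) (auto dest: finite_lts_trans)

lemma walk_append:
  assumes "finite_lts M"
  shows "walk M s (us @ vs) \<longleftrightarrow> walk M s us \<and> walk M (endpoint s us) vs"
  using assms by (induction us arbitrary: s) (auto dest: walk_states)

lemma walk_transitions: "walk M s ts \<Longrightarrow> set ts \<subseteq> transitions M"
  by (induction ts arbitrary: s) auto

lemma walk_snoc:
  assumes "finite_lts M" "walk M s ts" "(endpoint s ts, a, s') \<in> transitions M"
  shows "walk M s (ts @ [(endpoint s ts, a, s')])"
  using assms finite_lts_trans(3)[of M "(endpoint s ts, a, s')"] by (simp add: walk_append)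

section \<open>Semantics of the derived operators\<close>

lemma sem_coincidence:
  "(\<And>x. x \<in> free_vars \<phi> \<Longrightarrow> e x = e' x) \<Longrightarrow> sem M e \<phi> = sem M e' \<phi>"
proof (induction \<phi> arbitrary: e e')
  case (Mu x \<phi>)
  have "sem M (e(x := U)) \<phi> = sem M (e'(x := U)) \<phi>" for U
    by (rule Mu.IH) (use Mu.prems in auto)
  then show ?case by simp
next
  case (Or \<phi> \<psi>)
  have "sem M e \<phi> = sem M e' \<phi>" "sem M e \<psi> = sem M e' \<psi>"
    by (rule Or.IH, use Or.prems in simp)+
  then show ?case by simp
next
  case (Neg \<phi>)
  have "sem M e \<phi> = sem M e' \<phi>"
    by (rule Neg.IH) (use Neg.prems in simp)
  then show ?case by simp
next
  case (Dia1 a \<phi>)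
  have "sem M e \<phi> = sem M e' \<phi>"
    by (rule Dia1.IH) (use Dia1.prems in simp)
  then show ?case by simp
qed auto

lemma finite_free_vars: "finite (free_vars \<phi>)"
  by (induction \<phi>) auto

lemma fresh_notin_free_vars: "fresh \<phi> \<notin> free_vars \<phi>"
  unfolding fresh_def
  by (rule LeastI_ex) (use ex_new_if_finite[OF infinite_UNIV_nat finite_free_vars] in blast)

lemma sem_upd_fresh [simp]: "sem M (e(fresh \<phi> := U)) \<phi> = sem M e \<phi>"
  by (rule sem_coincidence) (use fresh_notin_free_vars[of \<phi>] in auto)

section \<open>Finite connectives and greatest fixpoints\<close>

lemma set_enumeration: "finite A \<Longrightarrow> set (enumeration A) = A"
  unfolding enumeration_def by (rule someI2_ex) (auto intro: finite_distinct_list)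

lemma sem_TT [simp]: "sem M e TT = states M"
  by (simp add: TT_def)

lemma sem_And [simp]: "sem M e (And \<phi> \<psi>) = states M \<inter> sem M e \<phi> \<inter> sem M e \<psi>"
  by (auto simp: And_def)

lemma sem_BigOr: "finite A \<Longrightarrow> sem M e (BigOr A f) = (\<Union>x\<in>A. sem M e (f x))"
proof -
  assume A: "finite A"
  have "sem M e (foldr (\<lambda>x. Or (f x)) xs FF) = (\<Union>x\<in>set xs. sem M e (f x))" for xs
    by (induction xs) auto
  then show ?thesis by (simp add: BigOr_def set_enumeration A)
qed

lemma sem_BigAnd:
  "finite A \<Longrightarrow> sem M e (BigAnd A f) = {s \<in> states M. \<forall>x\<in>A. s \<in> sem M e (f x)}"
proof -
  assume A: "finite A"
  have "sem M e (foldr (\<lambda>x. And (f x)) xs TT) = {s \<in> states M. \<forall>x\<in>set xs. s \<in> sem M e (f x)}" for xs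
    by (induction xs) auto
  then show ?thesis by (simp add: BigAnd_def set_enumeration A)
qed

text \<open>This is the substitution lemma for \<open>Neg (Var x)\<close>: a binder of
  \<open>x\<close> overrides the changed value of \<open>x\<close>, and the update made by any other
  binder commutes with that change.\<close>

lemma sem_neg_var: "sem M e (neg_var x \<phi>) = sem M (e(x := states M - e x)) \<phi>"
proof (induction \<phi> arbitrary: e)
  case (Mu y \<phi>)
  show ?case
  proof (cases "y = x")
    case False
    have "(e(y := U))(x := states M - (e(y := U)) x) = (e(x := states M - e x))(y := U)" for U
      using False by (auto simp: fun_eq_iff)
    then have "sem M (e(y := U)) (neg_var x \<phi>) = sem M ((e(x := states M - e x))(y := U)) \<phi>" for U
      using Mu[of "e(y := U)"] by metis
    with False show ?thesis by (simp del: fun_upd_apply)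
  qed (simp del: fun_upd_apply)
qed auto

text \<open>Complementation within \<open>states M\<close> exchanges the sets closed under the dual
  body with the sets contained in their own image, and so the intersection with a union.\<close>

lemma sem_Nu:
  "sem M e (Nu x \<phi>) = \<Union> {V. V \<subseteq> states M \<and> V \<subseteq> sem M (e(x := V)) \<phi>}"
proof (intro equalityI subsetI)
  fix s assume "s \<in> sem M e (Nu x \<phi>)"
  then obtain U where U: "s \<in> states M" "U \<subseteq> states M" "s \<notin> U"
      "states M - sem M (e(x := states M - U)) \<phi> \<subseteq> U"
    by (auto simp: Nu_def sem_neg_var)
  then show "s \<in> \<Union> {V. V \<subseteq> states M \<and> V \<subseteq> sem M (e(x := V)) \<phi>}"
    by (intro UnionI[of "states M - U"]) auto
next
  fix s assume "s \<in> \<Union> {V. V \<subseteq> states M \<and> V \<subseteq> sem M (e(x := V)) \<phi>}"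
  then obtain V where V: "V \<subseteq> states M" "V \<subseteq> sem M (e(x := V)) \<phi>" "s \<in> V" by auto
  have "states M - (states M - V) = V" using V(1) by auto
  with V show "s \<in> sem M e (Nu x \<phi>)"
    by (auto simp: Nu_def sem_neg_var intro!: exI[of _ "states M - V"])
qed

text \<open>The induction varies \<open>\<phi>\<close> for \<open>Seq\<close> and also
  \<open>e\<close> for \<open>Star\<close>, where the bound variable ranges over sets of states. An
  environment may contain points outside \<open>states M\<close>, whereas even an empty walk starts
  in a state; hence the bound on \<open>sem M e \<phi>\<close>.\<close>

lemma sem_Dia:
  assumes M: "finite_lts M"
  shows "\<lbrakk>finite (regular_acts R); sem M e \<phi> \<subseteq> states M\<rbrakk> \<Longrightarrow> sem M e (Dia R \<phi>) =
    {s. \<exists>ts. walk M s ts \<and> map lab ts \<in> lang R \<and> endpoint s ts \<in> sem M e \<phi>}"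
proof (induction R arbitrary: e \<phi>)
  case Eps
  then show ?case by auto
next
  case (Acts \<alpha>)
  show ?case
  proof (intro equalityI subsetI)
    fix s assume "s \<in> sem M e (Dia (Acts \<alpha>) \<phi>)"
    then obtain b s' where "b \<in> \<alpha>" "(s, b, s') \<in> transitions M" "s' \<in> sem M e \<phi>"
      using Acts by (auto simp: sem_BigOr)
    then show "s \<in> {s. \<exists>ts. walk M s ts \<and> map lab ts \<in> lang (Acts \<alpha>) \<and> endpoint s ts \<in> sem M e \<phi>}"
      using Acts(2) by (auto simp: lab_def tgt_def intro!: exI[of _ "[(s, b, s')]"])
  next
    fix s assume "s \<in> {s. \<exists>ts. walk M s ts \<and> map lab ts \<in> lang (Acts \<alpha>) \<and> endpoint s ts \<in> sem M e \<phi>}"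
    then obtain t where "fst t = s" "t \<in> transitions M" "lab t \<in> \<alpha>" "tgt t \<in> sem M e \<phi>"
      by auto
    moreover from this have "s \<in> states M" using finite_lts_trans(1)[OF M, of t] by simp
    ultimately show "s \<in> sem M e (Dia (Acts \<alpha>) \<phi>)"
      using Acts by (cases t) (auto simp: sem_BigOr lab_def tgt_def)
  qed
next
  case (Seq R Q)
  have Q: "sem M e (Dia Q \<phi>) =
      {s. \<exists>ts. walk M s ts \<and> map lab ts \<in> lang Q \<and> endpoint s ts \<in> sem M e \<phi>}"
    using Seq by auto
  then have "sem M e (Dia Q \<phi>) \<subseteq> states M" using walk_states[OF M] by auto
  then have R: "sem M e (Dia R (Dia Q \<phi>)) =
      {s. \<exists>ts. walk M s ts \<and> map lab ts \<in> lang R \<and> endpoint s ts \<in> sem M e (Dia Q \<phi>)}"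
    using Seq by auto
  show ?case unfolding Dia.simps R Q
  proof (intro equalityI subsetI; clarsimp)
    fix s us vs
    assume "walk M s us" "map lab us \<in> lang R" "walk M (endpoint s us) vs" "map lab vs \<in> lang Q"
      "endpoint (endpoint s us) vs \<in> sem M e \<phi>"
    then show "\<exists>ts. walk M s ts \<and> (\<exists>u v. map lab ts = u @ v \<and> u \<in> lang R \<and> v \<in> lang Q) \<and>
        endpoint s ts \<in> sem M e \<phi>"
      by (intro exI[of _ "us @ vs"]) (auto simp: walk_append[OF M])
  next
    fix s ts u v
    assume "walk M s ts" "endpoint s ts \<in> sem M e \<phi>" "map lab ts = u @ v" "u \<in> lang R" "v \<in> lang Q"
    then show "\<exists>ts. walk M s ts \<and> map lab ts \<in> lang R \<and>
        (\<exists>tsa. walk M (endpoint s ts) tsa \<and> map lab tsa \<in> lang Q \<and>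
          endpoint (endpoint s ts) tsa \<in> sem M e \<phi>)"
      by (auto simp: map_eq_append_conv walk_append[OF M]) blast
  qed
next
  case (Alt R Q)
  then show ?case by auto
next
  case (Star R)
  let ?y = "fresh \<phi>"
  let ?S = "{s. \<exists>ts. walk M s ts \<and> map lab ts \<in> lang (Star R) \<and> endpoint s ts \<in> sem M e \<phi>}"
  have IH: "sem M (e(?y := U)) (Dia R (Var ?y)) =
      {s. \<exists>ts. walk M s ts \<and> map lab ts \<in> lang R \<and> endpoint s ts \<in> U}" if "U \<subseteq> states M" for U
    using Star.IH[of "e(?y := U)" "Var ?y"] Star.prems that
    by (simp del: fun_upd_apply add: fun_upd_same)
  have sem: "sem M e (Dia (Star R) \<phi>) = \<Inter> {U. U \<subseteq> states M \<and>
      {s. \<exists>ts. walk M s ts \<and> map lab ts \<in> lang R \<and> endpoint s ts \<in> U} \<union> sem M e \<phi> \<subseteq> U}"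
    using IH by (simp cong: conj_cong del: fun_upd_apply add: lang.simps(5)[symmetric] del: lang.simps(5))
  have "?S \<subseteq> U" if U: "U \<subseteq> states M"
      "{s. \<exists>ts. walk M s ts \<and> map lab ts \<in> lang R \<and> endpoint s ts \<in> U} \<union> sem M e \<phi> \<subseteq> U" for U
  proof -
    \<comment> \<open>Induction on the number of iterations: the walk is cut after its first word,
      and closure of \<open>U\<close> carries membership back from the cut to
      \<open>s\<close>.\<close>
    have "s \<in> U" if "set us \<subseteq> lang R" "map lab ts = concat us" "walk M s ts" "endpoint s ts \<in> sem M e \<phi>"
      for us s ts
      using that
    proof (induction us arbitrary: s ts)
      case Nil
      then show ?case using U by auto
    next
      case (Cons u us)
      then obtain vs ws where ts: "ts = vs @ ws" "map lab vs = u" "map lab ws = concat us"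
        by (auto simp: map_eq_append_conv)
      with Cons have "endpoint s vs \<in> U" by (auto simp: walk_append[OF M])
      then show ?case using U Cons.prems ts by (auto simp: walk_append[OF M])
    qed
    then show ?thesis by auto
  qed
  moreover have "?S \<subseteq> states M" using walk_states[OF M] by auto
  moreover have "{s. \<exists>ts. walk M s ts \<and> map lab ts \<in> lang R \<and> endpoint s ts \<in> ?S} \<subseteq> ?S"
  proof clarsimp
    fix s vs ws us
    assume *: "walk M s vs" "map lab vs \<in> lang R" "walk M (endpoint s vs) ws" "map lab ws = concat us"
      "set us \<subseteq> lang R" "endpoint (endpoint s vs) ws \<in> sem M e \<phi>"
    then have "map lab (vs @ ws) = concat (map lab vs # us) \<and> set (map lab vs # us) \<subseteq> lang R"
      by simp
    with * show "\<exists>ts. walk M s ts \<and> (\<exists>us. map lab ts = concat us \<and> set us \<subseteq> lang R) \<and>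
        endpoint s ts \<in> sem M e \<phi>"
      by (intro exI[of _ "vs @ ws"] conjI exI[of _ "map lab vs # us"]) (auto simp: walk_append[OF M])
  qed
  moreover have "sem M e \<phi> \<subseteq> ?S"
    using Star.prems by (auto intro!: exI[of _ "[]"])
  ultimately show ?case unfolding sem by (intro equalityI Inter_lower Inter_greatest) auto
qed

section \<open>One-step modalities\<close>

lemma sem_Dia_Acts:
  assumes "finite_lts M" "\<alpha> \<subseteq> acts M"
  shows "sem M e (Dia (Acts \<alpha>) \<phi>) =
    {s. \<exists>b\<in>\<alpha>. \<exists>s'. (s, b, s') \<in> transitions M \<and> s' \<in> sem M e \<phi>}"
  using assms by (auto simp: sem_BigOr finite_lts_def finite_subset)

lemma sem_Box_Acts_FF:
  assumes "finite_lts M" "\<alpha> \<subseteq> acts M"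
  shows "sem M e (Box (Acts \<alpha>) FF) = {s \<in> states M. \<forall>b\<in>\<alpha>. \<not> enabled M b s}"
  unfolding Box_def sem.simps sem_Dia_Acts[OF assms]
  using finite_lts_step[OF assms(1)] by (auto simp: enabled_def)

lemma lang_Star_Acts: "lang (Star (Acts \<alpha>)) = lists \<alpha>"
proof (intro equalityI subsetI)
  fix w assume "w \<in> lists \<alpha>"
  then have "w = concat (map (\<lambda>a. [a]) w)" "set (map (\<lambda>a. [a]) w) \<subseteq> {[a] | a. a \<in> \<alpha>}"
    by (auto simp: lists_eq_set)
  then show "w \<in> lang (Star (Acts \<alpha>))"
    by (simp only: lang.simps mem_Collect_eq) blast
qed (fastforce simp: lists_eq_set)

text \<open>
  The states satisfying the inner least fixpoint for the action \<open>a\<close>, with \<open>V\<close> for the outer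
  variable and \<open>E\<close> for the actions that must stay disabled.
\<close>

definition serves :: "('s, 'a) lts \<Rightarrow> 'a set \<Rightarrow> 'a set \<Rightarrow> 's set \<Rightarrow> 'a \<Rightarrow> 's \<Rightarrow> bool" where
  "serves M \<alpha> E V a s \<longleftrightarrow> (\<exists>ts. walk M s ts \<and> ts \<noteq> [] \<and> lab (last ts) = a \<and> endpoint s ts \<in> V \<and>
     (\<forall>t\<in>set ts. lab t \<notin> \<alpha> \<and> (\<forall>b\<in>E. \<not> enabled M b (fst t))))"

text \<open>Unfolding \<open>W\<close> prepends a transition to the walk; passing to
  \<open>X\<close> is its final transition, labelled \<open>a\<close> and entering \<open>V\<close>.
  So the states with such a walk form a closed set for the body that lies in every other closed
  set.\<close>

lemma sem_serves:
  assumes M: "finite_lts M" and "E \<subseteq> acts M" "a \<in> acts M" "X \<noteq> W" and V: "V \<subseteq> states M"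
  shows "sem M (e(X := V)) (Mu W (And (BigAnd E (\<lambda>b. Box (Acts {b}) FF))
      (Or (Dia (Acts ({a} - \<alpha>)) (Var X)) (Dia (Acts (acts M - \<alpha>)) (Var W))))) =
    {s. serves M \<alpha> E V a s}" (is "?L = ?S")
proof -
  let ?G = "\<lambda>U. {s \<in> states M. (\<forall>b\<in>E. \<not> enabled M b s) \<and>
    (a \<notin> \<alpha> \<and> (\<exists>s'. (s, a, s') \<in> transitions M \<and> s' \<in> V) \<or>
     (\<exists>c\<in>acts M - \<alpha>. \<exists>s'. (s, c, s') \<in> transitions M \<and> s' \<in> U))}"
  have fin: "finite E" using assms by (auto simp: finite_lts_def intro: finite_subset)
  have box: "sem M e' (Box (Acts {b}) FF) = {s \<in> states M. \<not> enabled M b s}" if "b \<in> E" for b e'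
    using that assms(2) by (subst sem_Box_Acts_FF[OF M]) auto
  have dia: "sem M e' (Dia (Acts ({a} - \<alpha>)) \<phi>) =
      {s. \<exists>b\<in>{a} - \<alpha>. \<exists>s'. (s, b, s') \<in> transitions M \<and> s' \<in> sem M e' \<phi>}" for e' and \<phi> :: "'b fm"
    using assms(3) by (intro sem_Dia_Acts[OF M]) auto
  have dia': "sem M e' (Dia (Acts (acts M - \<alpha>)) \<phi>) =
      {s. \<exists>b\<in>acts M - \<alpha>. \<exists>s'. (s, b, s') \<in> transitions M \<and> s' \<in> sem M e' \<phi>}" for e' and \<phi> :: "'b fm"
    by (intro sem_Dia_Acts[OF M]) auto
  have body: "sem M (e(X := V, W := U)) (And (BigAnd E (\<lambda>b. Box (Acts {b}) FF))
      (Or (Dia (Acts ({a} - \<alpha>)) (Var X)) (Dia (Acts (acts M - \<alpha>)) (Var W)))) = ?G U" for U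
    unfolding sem_And sem_BigAnd[OF fin] sem.simps(2,4) dia dia' using assms(4)
    by (auto simp: box)
  have L: "?L = \<Inter> {U. U \<subseteq> states M \<and> ?G U \<subseteq> U}"
    unfolding sem.simps(6) body ..
  have least: "?S \<subseteq> U" if U: "?G U \<subseteq> U" for U
  proof clarify
    fix s assume "serves M \<alpha> E V a s"
    then obtain ts where "walk M s ts" "ts \<noteq> []" "lab (last ts) = a" "endpoint s ts \<in> V"
      "\<forall>t\<in>set ts. lab t \<notin> \<alpha> \<and> (\<forall>b\<in>E. \<not> enabled M b (fst t))"
      unfolding serves_def by blast
    \<comment> \<open>Induction along the walk: a single transition uses the disjunct for
      \<open>X\<close>, a longer walk the one for \<open>W\<close>.\<close>
    then show "s \<in> U"
    proof (induction ts arbitrary: s)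
      case (Cons t ts)
      obtain c s' where t: "t = (s, c, s')" "(s, c, s') \<in> transitions M"
        using Cons.prems(1) by (cases t) auto
      note st = finite_lts_step[OF M t(2)]
      show ?case
      proof (cases "ts = []")
        case True
        with Cons.prems t st have "s \<in> ?G U" by (auto simp: lab_def tgt_def)
        with U show ?thesis by blast
      next
        case False
        with Cons t have "s' \<in> U" by (auto simp: tgt_def)
        with Cons.prems t st have "s \<in> ?G U" by (auto simp: lab_def)
        with U show ?thesis by blast
      qed
    qed simp
  qed
  have "?S \<subseteq> states M" using walk_states[OF M] by (auto simp: serves_def)
  moreover have "?G ?S \<subseteq> ?S"
  proof
    fix s assume s: "s \<in> ?G ?S"
    then have quiet: "s \<in> states M" "\<forall>b\<in>E. \<not> enabled M b s" by auto
    from s consider (now) s' where "a \<notin> \<alpha>" "(s, a, s') \<in> transitions M" "s' \<in> V"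
      | (later) c s' where "c \<notin> \<alpha>" "(s, c, s') \<in> transitions M" "serves M \<alpha> E V a s'" by blast
    then show "s \<in> ?S"
    proof cases
      case now
      with quiet V show ?thesis
        by (auto simp: serves_def lab_def tgt_def intro!: exI[of _ "[(s, a, s')]"])
    next
      case later
      then obtain ts where "walk M s' ts" "ts \<noteq> []" "lab (last ts) = a" "endpoint s' ts \<in> V"
        "\<forall>t\<in>set ts. lab t \<notin> \<alpha> \<and> (\<forall>b\<in>E. \<not> enabled M b (fst t))"
        unfolding serves_def by blast
      with quiet later(1,2) show ?thesis
        unfolding serves_def mem_Collect_eq
        by (intro exI[of _ "(s, c, s') # ts"]) (auto simp: lab_def tgt_def)
    qed
  qed
  ultimately have "?S \<in> {U. U \<subseteq> states M \<and> ?G U \<subseteq> U}" by blast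
  moreover have "?S \<subseteq> \<Inter> {U. U \<subseteq> states M \<and> ?G U \<subseteq> U}" using least by blast
  ultimately show ?thesis unfolding L by blast
qed

lemma sem_serves_Nu:
  assumes M: "finite_lts M" and "E \<subseteq> acts M" "F \<subseteq> acts M" "X \<noteq> W"
  shows "s \<in> sem M e (Nu X (BigAnd F (\<lambda>a. Mu W (And (BigAnd E (\<lambda>b. Box (Acts {b}) FF))
      (Or (Dia (Acts ({a} - \<alpha>)) (Var X)) (Dia (Acts (acts M - \<alpha>)) (Var W))))))) \<longleftrightarrow>
    (\<exists>V. V \<subseteq> states M \<and> s \<in> V \<and> (\<forall>v\<in>V. \<forall>a\<in>F. serves M \<alpha> E V a v))"
proof -
  have F: "finite F" using assms by (auto simp: finite_lts_def intro: finite_subset)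
  have mu: "sem M (e(X := V)) (Mu W (And (BigAnd E (\<lambda>b. Box (Acts {b}) FF))
      (Or (Dia (Acts ({a} - \<alpha>)) (Var X)) (Dia (Acts (acts M - \<alpha>)) (Var W))))) =
      {s. serves M \<alpha> E V a s}" if "V \<subseteq> states M" "a \<in> F" for V a
    using that assms(3) by (intro sem_serves[OF M assms(2) _ assms(4)]) auto
  let ?\<phi> = "BigAnd F (\<lambda>a. Mu W (And (BigAnd E (\<lambda>b. Box (Acts {b}) FF))
      (Or (Dia (Acts ({a} - \<alpha>)) (Var X)) (Dia (Acts (acts M - \<alpha>)) (Var W)))))"
  have "sem M (e(X := V)) ?\<phi> = {s \<in> states M. \<forall>a\<in>F. serves M \<alpha> E V a s}"
    if V: "V \<subseteq> states M" for V
    unfolding sem_BigAnd[OF F] by (intro Collect_cong conj_cong refl ball_cong) (simp only: mu[OF V] mem_Collect_eq)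
  then have *: "V \<subseteq> sem M (e(X := V)) ?\<phi> \<longleftrightarrow> (\<forall>v\<in>V. \<forall>a\<in>F. serves M \<alpha> E V a v)"
    if "V \<subseteq> states M" for V
    using that by (simp only:) blast
  \<comment> \<open>The equivalence \<open>*\<close> is available only for sets of states; this rule
    applies it under the union while the formula stays folded.\<close>
  have "(\<And>V. P V \<Longrightarrow> Q V \<longleftrightarrow> R V) \<Longrightarrow> s \<in> \<Union> {V. P V \<and> Q V} \<longleftrightarrow> (\<exists>V. P V \<and> s \<in> V \<and> R V)"
    for P Q R by blast
  then show ?thesis unfolding sem_Nu using * .
qed

section \<open>Fair runs\<close>

text \<open>"Infinitely often", phrased by tails to match the quantification over suffixes in strong
  fairness.\<close>

definition io :: "('b \<Rightarrow> bool) \<Rightarrow> 'b stream \<Rightarrow> bool" where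
  "io P xs \<longleftrightarrow> (\<forall>m. \<exists>x\<in>sset (sdrop m xs). P x)"

lemma io_shift [simp]: "io P (ys @- xs) \<longleftrightarrow> io P xs"
proof (induction ys)
  case (Cons y ys)
  have "io P (y ## zs) \<longleftrightarrow> io P zs" for zs
  proof
    assume "io P (y ## zs)"
    then show "io P zs" unfolding io_def by (metis sdrop.simps(2) stream.sel(2))
  next
    assume *: "io P zs"
    show "io P (y ## zs)" unfolding io_def
    proof
      fix m
      \<comment> \<open>For \<open>m = 0\<close> the truncated \<open>m - 1\<close> is again 0, and
        the witness found in \<open>zs\<close> also lies in \<open>y ## zs\<close>.\<close>
      show "\<exists>x\<in>sset (sdrop m (y ## zs)). P x"
        using *[unfolded io_def, rule_format, of "m - 1"] by (cases m) auto
    qed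
  qed
  with Cons show ?case by simp
qed simp

lemma io_sdrop [simp]: "io P (sdrop n xs) \<longleftrightarrow> io P xs"
  by (metis io_shift stake_sdrop)

lemma sset_sdrop_mono: "m \<le> n \<Longrightarrow> sset (sdrop n xs) \<subseteq> sset (sdrop m xs)"
proof -
  assume "m \<le> n"
  then obtain k where "n = m + k" using le_Suc_ex by blast
  then show ?thesis by (metis UnCI sdrop_add sset_shift stake_sdrop subsetI)
qed

section \<open>Tails and states of infinite paths\<close>

lemma is_path_Inf_shift:
  assumes M: "finite_lts M"
  shows "is_path M (Inf s (us @- ts)) \<longleftrightarrow> walk M s us \<and> is_path M (Inf (endpoint s us) ts)"
proof (induction us arbitrary: s)
  case Nil
  \<comment> \<open>The prefix of length 0 yields \<open>s \<in> states M\<close>, which is what the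
    empty walk demands.\<close>
  have "is_path M (Inf s ts) \<Longrightarrow> walk M s []" by (metis is_path.simps(2) stake.simps(1))
  then show ?case by auto
next
  case (Cons t us)
  have "is_path M (Inf s (t ## xs)) \<longleftrightarrow> fst t = s \<and> t \<in> transitions M \<and> is_path M (Inf (tgt t) xs)" for xs
  proof
    assume *: "is_path M (Inf s (t ## xs))"
    then have "walk M s (t # stake n xs)" for n
      unfolding is_path.simps by (metis stake.simps(2) stream.sel(1,2))
    then show "fst t = s \<and> t \<in> transitions M \<and> is_path M (Inf (tgt t) xs)" by simp
  next
    assume *: "fst t = s \<and> t \<in> transitions M \<and> is_path M (Inf (tgt t) xs)"
    have "walk M s (stake n (t ## xs))" for n
      using * finite_lts_trans(1)[OF M, of t] by (cases n) auto
    then show "is_path M (Inf s (t ## xs))" by simp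
  qed
  with Cons show ?case by auto
qed

text \<open>Cutting the stream right behind position \<open>n\<close> makes the transition there the
  last one of a finite walk.\<close>

lemma is_path_snth:
  assumes "finite_lts M" "is_path M (Inf s ts)"
  shows "ts !! n \<in> transitions M" "fst (ts !! n) = endpoint s (stake n ts)"
  using assms(2) is_path_Inf_shift[OF assms(1), of s "stake n ts @ [ts !! n]" "sdrop (Suc n) ts"]
    id_stake_snth_sdrop[of ts n]
  by (auto simp: walk_append[OF assms(1)])

lemma is_path_sdrop:
  assumes "finite_lts M" "is_path M (Inf s ts)"
  shows "is_path M (Inf (endpoint s (stake n ts)) (sdrop n ts))"
  using assms(2) is_path_Inf_shift[OF assms(1), of s "stake n ts" "sdrop n ts"]
  unfolding stake_sdrop by blast

text \<open>Every target is the source of the next transition, and \<open>s\<close> is the source of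
  the first. Enabledness on a path thereby becomes a property of its transitions, to which
  \<open>io\<close> applies.\<close>

lemma path_states_Inf:
  assumes "finite_lts M" "is_path M (Inf s ts)"
  shows "path_states (Inf s ts) = fst ` sset ts"
proof -
  have "fst (ts !! 0) = s"
    unfolding is_path_snth(2)[OF assms] by simp
  moreover have "fst (ts !! Suc n) = tgt (ts !! n)" for n
    unfolding is_path_snth(2)[OF assms] stake_Suc by simp
  moreover have "range f = insert (f 0) (range (\<lambda>n. f (Suc n)))" for f :: "nat \<Rightarrow> 'a"
  proof (intro equalityI subsetI)
    fix y assume "y \<in> range f"
    then obtain n where "y = f n" by blast
    then show "y \<in> insert (f 0) (range (\<lambda>n. f (Suc n)))" by (cases n) auto
  qed auto
  from this[of "\<lambda>n. fst (ts !! n)"]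
  have "range (\<lambda>n. fst (ts !! n)) = insert (fst (ts !! 0)) (range (\<lambda>n. fst (ts !! Suc n)))" .
  ultimately show ?thesis by (simp add: sset_range image_image del: snth.simps)
qed

lemma is_suffix_Inf:
  "is_suffix \<pi> (Inf s ts) \<longleftrightarrow> (\<exists>n. \<pi> = Inf (endpoint s (stake n ts)) (sdrop n ts))"
proof
  assume "is_suffix \<pi> (Inf s ts)"
  then obtain \<pi>0 where "ends_in \<pi>0 (first \<pi>)" "Inf s ts = pappend \<pi>0 \<pi>"
    by (auto simp: is_suffix_def is_concat_def)
  then obtain us ts' where "\<pi> = Inf (endpoint s us) ts'" "ts = us @- ts'"
    by (cases \<pi>0; cases \<pi>) auto
  then show "\<exists>n. \<pi> = Inf (endpoint s (stake n ts)) (sdrop n ts)"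
    by (intro exI[of _ "length us"]) (simp add: stake_shift sdrop_shift)
next
  assume "\<exists>n. \<pi> = Inf (endpoint s (stake n ts)) (sdrop n ts)"
  then obtain n where "\<pi> = Inf (endpoint s (stake n ts)) (sdrop n ts)" ..
  then show "is_suffix \<pi> (Inf s ts)"
    unfolding is_suffix_def is_concat_def
    by (intro exI[of _ "Fin s (stake n ts)"]) (simp add: stake_sdrop)
qed

lemma relentlessly_enabled_Inf:
  assumes "finite_lts M" "is_path M (Inf s ts)"
  shows "relentlessly_enabled M a (Inf s ts) \<longleftrightarrow> io (\<lambda>t. enabled M a (fst t)) ts"
proof -
  have "relentlessly_enabled M a (Inf s ts) \<longleftrightarrow>
      (\<forall>n. \<exists>u\<in>path_states (Inf (endpoint s (stake n ts)) (sdrop n ts)). enabled M a u)"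
    unfolding relentlessly_enabled_def is_suffix_Inf by blast
  then show ?thesis
    unfolding path_states_Inf[OF assms(1) is_path_sdrop[OF assms]] io_def by (simp only: bex_simps)
qed

section \<open>Progressing and strongly fair paths\<close>

definition fair_run :: "('s, 'a) lts \<Rightarrow> 'a set \<Rightarrow> ('s, 'a) path \<Rightarrow> bool" where
  "fair_run M B \<pi> \<longleftrightarrow> is_path M \<pi> \<and> progressing M B \<pi> \<and> strongly_fair M B \<pi>"

text \<open>\<open>io\<close> is invariant under dropping a prefix, so relentless enabledness is the
  same for all suffixes. The quantifier over suffixes then affects only the occurrence of
  \<open>a\<close>, which turns into infinitely many occurrences.\<close>

lemma fair_run_Inf:
  assumes M: "finite_lts M"
  shows "fair_run M B (Inf s ts) \<longleftrightarrow> is_path M (Inf s ts) \<and>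
    (\<forall>a\<in>acts M - B. io (\<lambda>t. enabled M a (fst t)) ts \<longrightarrow> io (\<lambda>t. lab t = a) ts)"
proof (cases "is_path M (Inf s ts)")
  case True
  have "strongly_fair M B (Inf s ts) \<longleftrightarrow> (\<forall>n. \<forall>a\<in>acts M - B.
      io (\<lambda>t. enabled M a (fst t)) ts \<longrightarrow> a \<in> lab ` sset (sdrop n ts))"
  proof -
    have "strongly_fair M B (Inf s ts) \<longleftrightarrow> (\<forall>n. \<forall>a\<in>acts M - B.
        relentlessly_enabled M a (Inf (endpoint s (stake n ts)) (sdrop n ts)) \<longrightarrow>
        a \<in> occurring (Inf (endpoint s (stake n ts)) (sdrop n ts)))"
      unfolding strongly_fair_def is_suffix_Inf by blast
    then show ?thesis
      unfolding relentlessly_enabled_Inf[OF M is_path_sdrop[OF M True]] io_sdrop occurring.simps .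
  qed
  also have "\<dots> \<longleftrightarrow> (\<forall>a\<in>acts M - B. io (\<lambda>t. enabled M a (fst t)) ts \<longrightarrow> io (\<lambda>t. lab t = a) ts)"
    unfolding io_def[of "\<lambda>t. lab t = _"] by blast
  finally show ?thesis using True by (simp add: fair_run_def progressing_def)
qed (simp add: fair_run_def del: is_path.simps)

lemma is_suffix_Fin:
  "is_suffix \<pi> (Fin s ts) \<longleftrightarrow> (\<exists>us vs. ts = us @ vs \<and> \<pi> = Fin (endpoint s us) vs)"
proof
  assume "is_suffix \<pi> (Fin s ts)"
  then obtain \<pi>0 where "ends_in \<pi>0 (first \<pi>)" "Fin s ts = pappend \<pi>0 \<pi>"
    by (auto simp: is_suffix_def is_concat_def)
  then show "\<exists>us vs. ts = us @ vs \<and> \<pi> = Fin (endpoint s us) vs"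
    by (cases \<pi>0; cases \<pi>) auto
next
  assume "\<exists>us vs. ts = us @ vs \<and> \<pi> = Fin (endpoint s us) vs"
  then obtain us vs where "ts = us @ vs" "\<pi> = Fin (endpoint s us) vs" by blast
  then show "is_suffix \<pi> (Fin s ts)"
    unfolding is_suffix_def is_concat_def by (intro exI[of _ "Fin s us"]) simp
qed

text \<open>A relentlessly enabled action is enabled in the one-state suffix at the end. If that
  state is locked, the action is in \<open>B\<close>, so strong fairness holds vacuously.\<close>

lemma fair_run_Fin:
  "fair_run M B (Fin s ts) \<longleftrightarrow> walk M s ts \<and> locked M B (endpoint s ts)"
proof -
  have "strongly_fair M B (Fin s ts)" if locked: "locked M B (endpoint s ts)"
    unfolding strongly_fair_def
  proof (intro allI impI ballI)
    fix \<pi> a assume "is_suffix \<pi> (Fin s ts)" and a: "a \<in> acts M - B" "relentlessly_enabled M a \<pi>"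
    then obtain us vs where ts: "ts = us @ vs" "\<pi> = Fin (endpoint s us) vs"
      by (auto simp: is_suffix_Fin)
    have "is_suffix (Fin (endpoint s ts) []) \<pi>"
      unfolding ts is_suffix_Fin by (intro exI[of _ vs] exI[of _ "[]"]) simp
    with a have "enabled M a (endpoint s ts)"
      unfolding relentlessly_enabled_def by fastforce
    with locked a show "a \<in> occurring \<pi>" by (auto simp: locked_def)
  qed
  then show ?thesis by (auto simp: fair_run_def progressing_def)
qed

lemma first_pappend_Fin [simp]: "first (pappend (Fin s us) \<pi>) = s"
  by (cases \<pi>) auto

text \<open>The state \<open>s'\<close> is arbitrary because \<open>pappend\<close> discards the
  first state of its second argument; each use picks the state at which the two parts meet.\<close>

lemma pappend_Fin_append: "pappend (Fin s (us @ vs)) \<pi> = pappend (Fin s us) (pappend (Fin s' vs) \<pi>)"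
  by (cases \<pi>) auto

text \<open>A finite prefix changes neither the final state of a finite path nor what happens
  infinitely often on an infinite one.\<close>

lemma fair_run_pappend:
  assumes "finite_lts M" "first \<pi> = endpoint s us"
  shows "fair_run M B (pappend (Fin s us) \<pi>) \<longleftrightarrow> walk M s us \<and> fair_run M B \<pi>"
  using assms
  by (cases \<pi>) (auto simp: fair_run_Fin fair_run_Inf walk_append is_path_Inf_shift simp del: is_path.simps(2))

text \<open>The walks serving the actions of \<open>F\<close> in cyclic order are concatenated
  forever; each of them ends in \<open>V\<close>, so the next one can start there.\<close>

lemma round_robin:
  assumes M: "finite_lts M" and F: "finite F" "F \<noteq> {}" and s: "s \<in> V"
    and serves: "\<And>v a. v \<in> V \<Longrightarrow> a \<in> F \<Longrightarrow> serves M \<alpha> E V a v"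
  shows "\<exists>ts. is_path M (Inf s ts) \<and> (\<forall>a\<in>F. io (\<lambda>t. lab t = a) ts) \<and>
    (\<forall>t\<in>sset ts. lab t \<notin> \<alpha> \<and> (\<forall>b\<in>E. \<not> enabled M b (fst t)))"
proof -
  obtain l where l: "set l = F" using finite_list[OF F(1)] by blast
  define h where "h i = l ! (i mod length l)" for i
  have "l \<noteq> []" using l F by auto
  then have hF: "h i \<in> F" for i using l unfolding h_def by (metis length_greater_0_conv mod_less_divisor nth_mem)
  \<comment> \<open>The round \<open>m * length l + k\<close> is congruent to the position
    \<open>k\<close> of \<open>a\<close> in \<open>l\<close>, and at least \<open>m\<close> since
    \<open>l\<close> is nonempty.\<close>
  have hit: "\<exists>j\<ge>m. h j = a" if a: "a \<in> F" for a m
  proof -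
    obtain k where k: "k < length l" "l ! k = a" using a l by (metis in_set_conv_nth)
    then have "h (m * length l + k) = a" by (simp add: h_def)
    moreover have "m \<le> m * length l + k" using \<open>l \<noteq> []\<close> by (cases l) auto
    ultimately show ?thesis by blast
  qed
  obtain g where g: "\<And>v a. v \<in> V \<Longrightarrow> a \<in> F \<Longrightarrow> walk M v (g v a) \<and> g v a \<noteq> [] \<and>
      lab (last (g v a)) = a \<and> endpoint v (g v a) \<in> V \<and>
      (\<forall>t\<in>set (g v a). lab t \<notin> \<alpha> \<and> (\<forall>b\<in>E. \<not> enabled M b (fst t)))"
    using serves unfolding serves_def by metis
  \<comment> \<open>\<open>v i\<close> is the state at the start of round \<open>i\<close>, and
    \<open>w i\<close> the walk performed in that round.\<close>
  define v where "v = rec_nat s (\<lambda>i u. endpoint u (g u (h i)))"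
  define w where "w i = g (v i) (h i)" for i
  have v0: "v 0 = s" and vSuc: "v (Suc i) = endpoint (v i) (w i)" for i
    by (simp_all add: v_def w_def)
  have vV: "v i \<in> V" for i
    by (induction i) (use s g hF in \<open>auto simp: v0 vSuc w_def\<close>)
  have w: "walk M (v i) (w i)" "w i \<noteq> []" "lab (last (w i)) = h i"
    "\<forall>t\<in>set (w i). lab t \<notin> \<alpha> \<and> (\<forall>b\<in>E. \<not> enabled M b (fst t))" for i
    using g[OF vV hF] unfolding w_def by auto
  \<comment> \<open>\<open>r k\<close> is what remains from round \<open>k\<close> on, and
    \<open>p k\<close> the finite walk of the first \<open>k\<close> rounds.\<close>
  define r where "r k = flat (smap w (fromN k))" for k
  define p where "p k = concat (map w [0..<k])" for k
  have r: "r k = w k @- r (Suc k)" for k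
    unfolding r_def using w(2) by (subst flat_unfold) auto
  have split: "r 0 = p k @- r k" for k
  proof (induction k)
    case (Suc k)
    also have "p k @- r k = p (Suc k) @- r (Suc k)" by (subst r) (simp add: p_def)
    finally show ?case .
  qed (simp add: p_def)
  have walk_p: "walk M s (p k) \<and> endpoint s (p k) = v k" for k
  proof (induction k)
    case 0
    show ?case using walk_states(1)[OF M w(1), of 0] by (simp add: p_def v0)
  next
    case (Suc k)
    then show ?case using w(1)[of k] by (simp add: p_def vSuc walk_append[OF M])
  qed
  have len: "k \<le> length (p k)" for k
  proof (induction k)
    case (Suc k)
    then show ?case using w(2)[of k] by (cases "w k") (auto simp: p_def)
  qed simp
  \<comment> \<open>No round is empty, so \<open>n\<close> rounds cover the first \<open>n\<close>
    transitions.\<close>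
  have "walk M s (stake n (r 0))" for n
  proof -
    have "stake n (r 0) = take n (p n)" using split[of n] len[of n] by (simp add: stake_shift)
    moreover have "walk M s (take n (p n) @ drop n (p n))" using walk_p by simp
    ultimately show ?thesis unfolding walk_append[OF M] by simp
  qed
  moreover have "io (\<lambda>t. lab t = a) (r 0)" if a: "a \<in> F" for a
    unfolding io_def
  proof
    fix m
    \<comment> \<open>Round \<open>j\<close> starts at position \<open>m\<close> or later and its
      last transition is labelled \<open>a\<close>.\<close>
    obtain j where j: "j \<ge> m" "h j = a" using hit[OF a] by blast
    then have "m \<le> length (p j)" using len[of j] by simp
    then have "sset (r j) \<subseteq> sset (sdrop m (r 0))"
      using sset_sdrop_mono[of m "length (p j)" "r 0"] split[of j] by (simp add: sdrop_shift)
    moreover have "last (w j) \<in> sset (r j)" using r[of j] w(2)[of j] by simp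
    ultimately show "\<exists>t\<in>sset (sdrop m (r 0)). lab t = a" using w(3)[of j] j by blast
  qed
  moreover have "sset (smap w (fromN 0)) = range w"
    unfolding sset_range by (auto simp: image_def)
  then have "sset (r 0) = (\<Union>i. set (w i))"
    unfolding r_def using w(2) by (subst sset_flat) auto
  ultimately show ?thesis using w(4) by (intro exI[of _ "r 0"]) auto
qed

text \<open>Actions of \<open>F\<close> occur infinitely often by \<open>round_robin\<close>; the
  others outside \<open>B\<close> are never enabled along the run, so fairness demands nothing of
  them.\<close>

lemma fair_run_cycle:
  assumes M: "finite_lts M" and F: "F \<subseteq> acts M - B" "F \<noteq> {}" and "s \<in> V"
    and "\<And>v a. v \<in> V \<Longrightarrow> a \<in> F \<Longrightarrow> serves M \<alpha> (acts M - B - F) V a v"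
  shows "\<exists>ts. fair_run M B (Inf s ts) \<and> (\<forall>t\<in>sset ts. lab t \<notin> \<alpha>)"
proof -
  have "finite F" using M F(1) by (auto simp: finite_lts_def intro: finite_subset)
  then obtain ts where ts: "is_path M (Inf s ts)" "\<And>a. a \<in> F \<Longrightarrow> io (\<lambda>t. lab t = a) ts"
    "\<And>t. t \<in> sset ts \<Longrightarrow> lab t \<notin> \<alpha> \<and> (\<forall>b\<in>acts M - B - F. \<not> enabled M b (fst t))"
    using round_robin[OF M _ F(2) assms(4,5)] by blast
  have "a \<in> F" if a: "a \<in> acts M - B" "io (\<lambda>t. enabled M a (fst t)) ts" for a
  proof -
    obtain t where "t \<in> sset ts" "enabled M a (fst t)"
      using a(2) unfolding io_def by (metis sdrop.simps(1))
    with a(1) ts(3) show ?thesis by blast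
  qed
  with ts show ?thesis by (auto simp: fair_run_Inf[OF M])
qed

text \<open>This supplies the continuation after an event of \<open>\<alpha>e\<close>, where no
  action is forbidden any more; hence the empty set in \<open>serves\<close> below.\<close>

lemma fair_run_exists:
  assumes M: "finite_lts M" and s: "s \<in> states M"
  shows "\<exists>\<pi>. first \<pi> = s \<and> fair_run M B \<pi>"
proof -
  define Reach where "Reach u = {endpoint u ts | ts. walk M u ts}" for u
  have refl: "u \<in> Reach u" if "u \<in> states M" for u
    using that unfolding Reach_def by (auto intro!: exI[of _ "[]"])
  have trans: "Reach u \<subseteq> Reach v" if "u \<in> Reach v" for u v
  proof
    fix x assume "x \<in> Reach u"
    with that obtain us vs where "walk M v us" "u = endpoint v us" "walk M u vs" "x = endpoint u vs"
      unfolding Reach_def by blast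
    then show "x \<in> Reach v"
      unfolding Reach_def by (intro CollectI exI[of _ "us @ vs"]) (simp add: walk_append[OF M])
  qed
  have sub: "Reach u \<subseteq> states M" for u unfolding Reach_def using walk_states(2)[OF M] by auto
  have fin: "finite (Reach u)" for u
    using sub M by (auto simp: finite_lts_def intro: finite_subset)
  \<comment> \<open>Actions disabled throughout a reachable set are therefore disabled along every
    walk inside it.\<close>
  have source: "fst t \<in> Reach u" if walk: "walk M u ts" and t: "t \<in> set ts" for u ts t
  proof -
    obtain us vs where "ts = us @ t # vs" using split_list[OF t] by blast
    with walk have "walk M u us" "fst t = endpoint u us" by (auto simp: walk_append[OF M])
    then show ?thesis unfolding Reach_def by blast
  qed
  \<comment> \<open>A state with the fewest reachable states lies in a bottom strongly connected component.\<close>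
  obtain c where c: "c \<in> Reach s" "\<And>u. u \<in> Reach s \<Longrightarrow> card (Reach c) \<le> card (Reach u)"
    using arg_min_nat_lemma[of "\<lambda>u. u \<in> Reach s" s "\<lambda>u. card (Reach u)"] refl[OF s] by blast
  \<comment> \<open>Transitivity gives inclusion in \<open>Reach c\<close>, and minimality of the
    cardinality forces equality.\<close>
  have bottom: "Reach u = Reach c" if "u \<in> Reach c" for u
    using card_seteq[OF fin trans[OF that]] c(2)[of u] trans[OF c(1)] that by blast
  obtain us where us: "walk M s us" "c = endpoint s us" using c(1) unfolding Reach_def by blast
  have "\<exists>\<pi>. first \<pi> = c \<and> fair_run M B \<pi>"
  proof (cases "locked M B c")
    case True
    then show ?thesis using sub c(1) by (intro exI[of _ "Fin c []"]) (auto simp: fair_run_Fin)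
  next
    case False
    define F where "F = {a \<in> acts M - B. \<exists>v\<in>Reach c. enabled M a v}"
    have cc: "c \<in> Reach c" using refl sub c(1) by blast
    have "F \<noteq> {}"
      using False cc finite_lts_step(2)[OF M] unfolding F_def locked_def enabled_def by blast
    \<comment> \<open>From anywhere in the component, walk to a state \<open>v\<close> in which
      \<open>a\<close> is enabled and then execute \<open>a\<close>.\<close>
    moreover have "serves M {} (acts M - B - F) (Reach c) a u" if u: "u \<in> Reach c" and a: "a \<in> F" for u a
    proof -
      obtain v x where v: "v \<in> Reach c" "(v, a, x) \<in> transitions M"
        using a unfolding F_def enabled_def by blast
      obtain ts where ts: "walk M u ts" "v = endpoint u ts"
        using v(1) bottom[OF u] unfolding Reach_def by blast
      let ?ts = "ts @ [(v, a, x)]"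
      have walk: "walk M u ?ts" using walk_snoc[OF M ts(1)] v(2) ts(2) by simp
      moreover have "endpoint u ?ts \<in> Reach c"
        using walk bottom[OF u] unfolding Reach_def by blast
      moreover have "\<not> enabled M b (fst t)" if "t \<in> set ?ts" "b \<in> acts M - B - F" for t b
        using source[OF walk that(1)] that(2) bottom[OF u] unfolding F_def by blast
      moreover have "lab (last ?ts) = a" by (simp add: lab_def)
      ultimately show ?thesis unfolding serves_def by (intro exI[of _ ?ts]) blast
    qed
    moreover have "F \<subseteq> acts M - B" unfolding F_def by blast
    ultimately obtain ts where "fair_run M B (Inf c ts)"
      using fair_run_cycle[OF M _ _ cc, of F B "{}"] by blast
    then show ?thesis by (intro exI[of _ "Inf c ts"]) simp
  qed
  then obtain \<pi> where "first \<pi> = c" "fair_run M B \<pi>" by blast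
  with us show ?thesis
    by (intro exI[of _ "pappend (Fin s us) \<pi>"]) (simp add: fair_run_pappend[OF M])
qed

text \<open>A converse to \<open>fair_run_cycle\<close>, up to a finite prefix of length
  \<open>n\<close> after which the other actions outside \<open>B\<close> have become permanently
  disabled.\<close>

lemma fair_run_Inf_cycle:
  assumes M: "finite_lts M" and run: "fair_run M B (Inf s ts)" and free: "\<forall>t\<in>sset ts. lab t \<notin> \<alpha>"
  shows "\<exists>n. locked M B (endpoint s (stake n ts)) \<or>
    (\<exists>F V. F \<noteq> {} \<and> F \<subseteq> acts M - B \<and> V \<subseteq> states M \<and> endpoint s (stake n ts) \<in> V \<and>
      (\<forall>v\<in>V. \<forall>a\<in>F. serves M \<alpha> (acts M - B - F) V a v))"
proof -
  define F where "F = {a \<in> acts M - B. io (\<lambda>t. lab t = a) ts}"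
  define E where "E = acts M - B - F"
  have path: "is_path M (Inf s ts)" using run by (simp add: fair_run_Inf[OF M])
  note snth = is_path_snth[OF M path]
  have "\<exists>m. \<forall>t\<in>sset (sdrop m ts). \<not> enabled M b (fst t)" if "b \<in> E" for b
  proof -
    have "\<not> io (\<lambda>t. enabled M b (fst t)) ts"
      using run that unfolding E_def F_def fair_run_Inf[OF M] by blast
    then show ?thesis unfolding io_def by blast
  qed
  then obtain m where m: "\<And>b t. b \<in> E \<Longrightarrow> t \<in> sset (sdrop (m b) ts) \<Longrightarrow> \<not> enabled M b (fst t)"
    by metis
  have "finite E" using M unfolding E_def by (auto simp: finite_lts_def)
  then obtain N where N: "\<And>b. b \<in> E \<Longrightarrow> m b \<le> N"
    by (metis finite_imageI finite_nat_set_iff_bounded_le image_eqI)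
  have quiet: "\<not> enabled M b (fst (ts !! i))" if "b \<in> E" "N \<le> i" for b i
  proof -
    have "ts !! i = sdrop (m b) ts !! (i - m b)" using N[OF that(1)] that(2) by (simp add: sdrop_snth)
    then have "ts !! i \<in> sset (sdrop (m b) ts)" by (simp add: snth_sset)
    with m[OF that(1)] show ?thesis by blast
  qed
  let ?s = "\<lambda>i. endpoint s (stake i ts)"
  show ?thesis
  proof (cases "F = {}")
    case True
    \<comment> \<open>Every action outside \<open>B\<close> is disabled from position
      \<open>N\<close> on, although the path itself continues with actions of
      \<open>B\<close>.\<close>
    then have "locked M B (?s N)"
      using quiet[of _ N] finite_lts_step(2)[OF M] snth(2)[of N]
      unfolding locked_def E_def enabled_def by auto
    then show ?thesis by blast
  next
    case False
    define V where "V = {?s i | i. N \<le> i}"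
    have "serves M \<alpha> E V a (?s i)" if i: "N \<le> i" and a: "a \<in> F" for a i
    proof -
      obtain t where "t \<in> sset (sdrop i ts)" "lab t = a"
        using a unfolding F_def io_def by blast
      then obtain k where k: "lab (ts !! (i + k)) = a" by (auto simp: sset_range sdrop_snth)
      \<comment> \<open>The offset \<open>k\<close> counts from position \<open>i\<close>;
        \<open>Suc k\<close> transitions are taken so that the occurrence of \<open>a\<close> is the
        last of them.\<close>
      let ?us = "stake (Suc k) (sdrop i ts)"
      have "walk M (?s i) ?us" using is_path_sdrop[OF M path, of i] unfolding is_path.simps by blast
      moreover have "lab (last ?us) = a" using k by (simp add: stake_Suc sdrop_snth del: stake.simps(2))
      moreover have "endpoint (?s i) ?us \<in> V"
      proof -
        have "endpoint (?s i) ?us = ?s (i + Suc k)"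
          by (simp only: endpoint_append[symmetric] stake_add)
        then show ?thesis unfolding V_def using i by (metis (mono_tags, lifting) mem_Collect_eq trans_le_add1)
      qed
      moreover have "lab t \<notin> \<alpha> \<and> (\<forall>b\<in>E. \<not> enabled M b (fst t))" if t: "t \<in> set ?us" for t
      proof -
        obtain j where "t = ts !! (i + j)"
          using t by (auto simp: in_set_conv_nth stake_nth sdrop_snth simp del: stake.simps(2))
        then show ?thesis using free quiet[of _ "i + j"] i by (auto simp: snth_sset)
      qed
      ultimately show ?thesis unfolding serves_def by (intro exI[of _ ?us]) auto
    qed
    moreover have "?s i \<in> states M" for i
      using path walk_states(2)[OF M] by auto
    ultimately have "V \<subseteq> states M" "?s N \<in> V" "\<forall>v\<in>V. \<forall>a\<in>F. serves M \<alpha> E V a v"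
      unfolding V_def by auto
    moreover have "F \<subseteq> acts M - B" unfolding F_def by blast
    ultimately show ?thesis using False unfolding E_def by blast
  qed
qed

section \<open>States from which a violating run continues\<close>

text \<open>The disjunction under the outer diamond, read semantically. Membership in
  \<open>states M\<close> is explicit because points outside are vacuously locked.\<close>

definition target :: "('s, 'a) lts \<Rightarrow> 'a set \<Rightarrow> 'a set \<Rightarrow> 'a set \<Rightarrow> 's \<Rightarrow> bool" where
  "target M B \<alpha>f \<alpha>e s \<longleftrightarrow> s \<in> states M \<and> ((\<exists>e\<in>\<alpha>e. enabled M e s) \<or> locked M B s \<or>
     (\<exists>F V. F \<noteq> {} \<and> F \<subseteq> acts M - B \<and> V \<subseteq> states M \<and> s \<in> V \<and>
       (\<forall>v\<in>V. \<forall>a\<in>F. serves M \<alpha>f (acts M - B - F) V a v)))"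

lemma sem_target:
  assumes M: "finite_lts M" and "\<alpha>e \<subseteq> acts M" "X \<noteq> W"
  shows "sem M e (Or (Dia (Acts \<alpha>e) TT)
        (Or (Box (Acts (acts M - B)) FF)
            (BigOr {F. F \<noteq> {} \<and> F \<subseteq> acts M - B} (\<lambda>F.
               Nu X (BigAnd F (\<lambda>a.
                 Mu W (And (BigAnd ((acts M - B) - F) (\<lambda>b. Box (Acts {b}) FF))
                           (Or (Dia (Acts ({a} - \<alpha>f)) (Var X))
                               (Dia (Acts (acts M - \<alpha>f)) (Var W)))))))))) =
    {s. target M B \<alpha>f \<alpha>e s}" (is "sem M e (Or ?D (Or ?L ?C)) = _")
proof -
  have D: "s \<in> sem M e ?D \<longleftrightarrow> s \<in> states M \<and> (\<exists>e\<in>\<alpha>e. enabled M e s)" for s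
    unfolding sem_Dia_Acts[OF M assms(2)] enabled_def sem_TT using finite_lts_step[OF M] by blast
  have L: "s \<in> sem M e ?L \<longleftrightarrow> s \<in> states M \<and> locked M B s" for s
    unfolding sem_Box_Acts_FF[OF M Diff_subset] locked_def enabled_def
    using finite_lts_step(2)[OF M] by auto
  have fin: "finite {F. F \<noteq> {} \<and> F \<subseteq> acts M - B}"
    by (rule finite_subset[of _ "Pow (acts M)"]) (use M in \<open>auto simp: finite_lts_def\<close>)
  have C: "s \<in> sem M e ?C \<longleftrightarrow> (\<exists>F V. F \<noteq> {} \<and> F \<subseteq> acts M - B \<and> V \<subseteq> states M \<and> s \<in> V \<and>
       (\<forall>v\<in>V. \<forall>a\<in>F. serves M \<alpha>f (acts M - B - F) V a v))" for s
  proof -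
    let ?N = "\<lambda>F. Nu X (BigAnd F (\<lambda>a.
                 Mu W (And (BigAnd ((acts M - B) - F) (\<lambda>b. Box (Acts {b}) FF))
                           (Or (Dia (Acts ({a} - \<alpha>f)) (Var X))
                               (Dia (Acts (acts M - \<alpha>f)) (Var W))))))"
    have N: "s \<in> sem M e (?N F) \<longleftrightarrow>
        (\<exists>V. V \<subseteq> states M \<and> s \<in> V \<and> (\<forall>v\<in>V. \<forall>a\<in>F. serves M \<alpha>f (acts M - B - F) V a v))"
      if "F \<noteq> {} \<and> F \<subseteq> acts M - B" for F
      by (rule sem_serves_Nu[OF M _ _ assms(3)]) (use that in blast)+
    have "s \<in> sem M e ?C \<longleftrightarrow> (\<exists>F. (F \<noteq> {} \<and> F \<subseteq> acts M - B) \<and> s \<in> sem M e (?N F))"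
      unfolding sem_BigOr[OF fin] UN_iff Bex_def mem_Collect_eq ..
    also have "\<dots> \<longleftrightarrow> (\<exists>F. (F \<noteq> {} \<and> F \<subseteq> acts M - B) \<and>
        (\<exists>V. V \<subseteq> states M \<and> s \<in> V \<and> (\<forall>v\<in>V. \<forall>a\<in>F. serves M \<alpha>f (acts M - B - F) V a v)))"
      by (intro arg_cong[of _ _ Ex] ext conj_cong[OF refl] N)
    finally show ?thesis by (simp only: conj_assoc ex_simps)
  qed
  show ?thesis unfolding sem.simps(4)
    by (rule set_eqI) (simp only: Un_iff D L C target_def mem_Collect_eq; blast)
qed

text \<open>The walk along \<open>us\<close> and \<open>vs\<close> is prolonged by nothing in a
  locked state, by a serving cycle, or by an event followed by an arbitrary fair run.\<close>

lemma target_imp_run: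
  assumes M: "finite_lts M" and us: "walk M s us" "map lab us \<in> lang \<rho>"
    and vs: "walk M (endpoint s us) vs" "\<forall>t\<in>set vs. lab t \<notin> \<alpha>f"
    and goal: "target M B \<alpha>f \<alpha>e (endpoint (endpoint s us) vs)"
  shows "\<exists>\<pi>. first \<pi> = s \<and> fair_run M B \<pi> \<and> violating \<rho> \<alpha>f \<alpha>e \<pi>"
proof -
  let ?s1 = "endpoint s us" and ?s2 = "endpoint (endpoint s us) vs"
  have uvs: "walk M s (us @ vs)" using us vs by (simp add: walk_append[OF M])
  have free: ?thesis if "first \<pi> = ?s2" "fair_run M B \<pi>" "occurring \<pi> \<inter> \<alpha>f = {}" for \<pi>
  proof (intro exI conjI)
    let ?\<pi> = "pappend (Fin s (us @ vs)) \<pi>" and ?suf = "pappend (Fin ?s1 vs) \<pi>"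
    show "first ?\<pi> = s" by simp
    show "fair_run M B ?\<pi>" using that uvs by (simp add: fair_run_pappend[OF M])
    have "is_concat ?\<pi> (Fin s us) ?suf"
      by (simp add: is_concat_def pappend_Fin_append[of s us vs \<pi> ?s1])
    moreover have "free_of \<alpha>f ?suf"
      using that(3) vs(2) by (cases \<pi>) (auto simp: free_of_def)
    moreover have "matches (Fin s us) \<rho>" using us(2) by simp
    ultimately show "violating \<rho> \<alpha>f \<alpha>e ?\<pi>" unfolding violating_def by blast
  qed
  from goal consider (event) e where "e \<in> \<alpha>e" "enabled M e ?s2" | (locked) "locked M B ?s2"
    | (cycle) F V where "F \<noteq> {}" "F \<subseteq> acts M - B" "?s2 \<in> V"
      "\<forall>v\<in>V. \<forall>a\<in>F. serves M \<alpha>f (acts M - B - F) V a v"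
    unfolding target_def by blast
  then show ?thesis
  proof cases
    case event
    then obtain x where x: "(?s2, e, x) \<in> transitions M" unfolding enabled_def by blast
    let ?t = "(?s2, e, x)"
    obtain \<pi>3 where \<pi>3: "first \<pi>3 = x" "fair_run M B \<pi>3"
      using fair_run_exists[OF M finite_lts_step(3)[OF M x]] by blast
    \<comment> \<open>An action of \<open>\<alpha>e\<close> may occur already within
      \<open>vs\<close>, and violation refers to the first occurrence; so the walk is split there
      rather than at \<open>?t\<close>.\<close>
    have "\<exists>t\<in>set (vs @ [?t]). lab t \<in> \<alpha>e" using event by (simp add: lab_def)
    then obtain ys t zs where split: "vs @ [?t] = ys @ t # zs" "lab t \<in> \<alpha>e" "\<forall>y\<in>set ys. lab y \<notin> \<alpha>e"
      using split_list_first_prop[of "vs @ [?t]" "\<lambda>t. lab t \<in> \<alpha>e"] by blast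
    \<comment> \<open>The appended \<open>?t\<close> comes last, so \<open>ys\<close> is a prefix of
      \<open>vs\<close> and inherits the absence of \<open>\<alpha>f\<close>.\<close>
    have ys: "set ys \<subseteq> set vs"
    proof (cases zs rule: rev_cases)
      case Nil
      with split(1) show ?thesis by simp
    next
      case (snoc zs' z)
      then have "vs = ys @ t # zs'" using split(1) by simp
      then show ?thesis by auto
    qed
    let ?s3 = "endpoint ?s1 ys"
    have "walk M s ((us @ vs) @ [?t])" by (rule walk_snoc[OF M uvs, unfolded endpoint_append, OF x])
    then have walk: "walk M s (us @ ys @ t # zs)" using split(1) by simp
    then obtain a s' where t: "t = (?s3, a, s')" by (cases t) (auto simp: walk_append[OF M])
    have "endpoint s (us @ ys @ t # zs) = x"
      using arg_cong[OF split(1), of "endpoint ?s1"] by (simp add: tgt_def)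
    then have last: "first \<pi>3 = endpoint s (us @ ys @ t # zs)" using \<pi>3(1) by simp
    let ?\<pi>3 = "pappend (Fin s' zs) \<pi>3"
    let ?\<pi>2 = "pappend (Fin ?s3 (t # zs)) \<pi>3"
    let ?suf = "pappend (Fin ?s1 (ys @ t # zs)) \<pi>3"
    let ?\<pi> = "pappend (Fin s (us @ ys @ t # zs)) \<pi>3"
    have "is_concat ?\<pi> (Fin s us) ?suf"
      by (simp add: is_concat_def pappend_Fin_append[of s us "ys @ t # zs" \<pi>3 ?s1])
    moreover have "is_concat ?suf (Fin ?s1 ys) ?\<pi>2"
      by (simp add: is_concat_def pappend_Fin_append[of ?s1 ys "t # zs" \<pi>3 ?s3])
    moreover have "is_concat ?\<pi>2 (Fin ?s3 [(?s3, a, s')]) ?\<pi>3"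
      using pappend_Fin_append[of ?s3 "[t]" zs \<pi>3 s'] t by (simp add: is_concat_def tgt_def)
    moreover have "free_of \<alpha>e (Fin ?s1 ys)" "free_of \<alpha>f (Fin ?s1 ys)"
      using split(3) ys vs(2) by (auto simp: free_of_def)
    moreover have "a \<in> \<alpha>e" using split(2) t by (simp add: lab_def)
    moreover have "matches (Fin s us) \<rho>" using us(2) by simp
    ultimately have "violating \<rho> \<alpha>f \<alpha>e ?\<pi>" unfolding violating_def by blast
    moreover have "fair_run M B ?\<pi>" using fair_run_pappend[OF M last] walk \<pi>3(2) by blast
    ultimately show ?thesis by (intro exI[of _ ?\<pi>]) simp
  next
    case locked
    then show ?thesis
      using walk_states(2)[OF M vs(1)] by (intro free[of "Fin ?s2 []"]) (auto simp: fair_run_Fin)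
  next
    case cycle
    then obtain ts where "fair_run M B (Inf ?s2 ts)" "\<forall>t\<in>sset ts. lab t \<notin> \<alpha>f"
      using fair_run_cycle[OF M, of F B ?s2 V \<alpha>f] by blast
    then show ?thesis by (intro free[of "Inf ?s2 ts"]) auto
  qed
qed

text \<open>The part matching \<open>\<rho>\<close> gives \<open>us\<close>. Then \<open>vs\<close>
  is the stretch of the remaining run up to its locked end, up to the position found by
  \<open>fair_run_Inf_cycle\<close>, or up to the event.\<close>

lemma run_imp_target:
  assumes M: "finite_lts M" and run: "fair_run M B \<pi>" and viol: "violating \<rho> \<alpha>f \<alpha>e \<pi>"
  shows "\<exists>us vs. walk M (first \<pi>) us \<and> map lab us \<in> lang \<rho> \<and> walk M (endpoint (first \<pi>) us) vs \<and>
    (\<forall>t\<in>set vs. lab t \<notin> \<alpha>f) \<and> target M B \<alpha>f \<alpha>e (endpoint (endpoint (first \<pi>) us) vs)"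
proof -
  obtain \<pi>pre suf where concat: "is_concat \<pi> \<pi>pre suf" "matches \<pi>pre \<rho>"
    and suf: "free_of \<alpha>f suf \<or> (\<exists>\<pi>1 \<pi>2 s e s' \<pi>3. is_concat suf \<pi>1 \<pi>2 \<and>
       is_concat \<pi>2 (Fin s [(s, e, s')]) \<pi>3 \<and> e \<in> \<alpha>e \<and> free_of \<alpha>e \<pi>1 \<and> free_of \<alpha>f \<pi>1)"
    using viol unfolding violating_def by blast
  then obtain s us where pre: "\<pi>pre = Fin s us" "map lab us \<in> lang \<rho>" by (cases \<pi>pre) auto
  with concat(1) have \<pi>: "\<pi> = pappend (Fin s us) suf" "first suf = endpoint s us"
    by (auto simp: is_concat_def)
  let ?s1 = "endpoint s us"
  have us: "walk M s us" and run': "fair_run M B suf"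
    using run \<pi> by (auto simp: fair_run_pappend[OF M])
  have "\<exists>vs. walk M ?s1 vs \<and> (\<forall>t\<in>set vs. lab t \<notin> \<alpha>f) \<and> target M B \<alpha>f \<alpha>e (endpoint ?s1 vs)"
    using suf
  proof
    assume free: "free_of \<alpha>f suf"
    show ?thesis
    proof (cases suf)
      case (Fin s' vs)
      with \<pi>(2) run' have "walk M ?s1 vs" "locked M B (endpoint ?s1 vs)" by (auto simp: fair_run_Fin)
      moreover from this have "target M B \<alpha>f \<alpha>e (endpoint ?s1 vs)"
        using walk_states(2)[OF M] by (auto simp: target_def)
      moreover have "\<forall>t\<in>set vs. lab t \<notin> \<alpha>f" using free Fin by (auto simp: free_of_def)
      ultimately show ?thesis by blast
    next
      case (Inf s' ts)
      then have s': "s' = ?s1" using \<pi>(2) by simp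
      have free': "\<forall>t\<in>sset ts. lab t \<notin> \<alpha>f" using free Inf by (auto simp: free_of_def)
      have run'': "fair_run M B (Inf ?s1 ts)" using run' Inf s' by simp
      obtain n where n: "locked M B (endpoint ?s1 (stake n ts)) \<or>
          (\<exists>F V. F \<noteq> {} \<and> F \<subseteq> acts M - B \<and> V \<subseteq> states M \<and> endpoint ?s1 (stake n ts) \<in> V \<and>
            (\<forall>v\<in>V. \<forall>a\<in>F. serves M \<alpha>f (acts M - B - F) V a v))"
        using fair_run_Inf_cycle[OF M run'' free'] by blast
      have walk: "walk M ?s1 (stake n ts)" using run'' by (simp add: fair_run_def)
      then have "target M B \<alpha>f \<alpha>e (endpoint ?s1 (stake n ts))"
        using n walk_states(2)[OF M walk] unfolding target_def by blast
      moreover have "\<forall>t\<in>set (stake n ts). lab t \<notin> \<alpha>f"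
        using free' by (metis UnCI sset_shift stake_sdrop)
      ultimately show ?thesis using walk by blast
    qed
  next
    assume "\<exists>\<pi>1 \<pi>2 s e s' \<pi>3. is_concat suf \<pi>1 \<pi>2 \<and>
       is_concat \<pi>2 (Fin s [(s, e, s')]) \<pi>3 \<and> e \<in> \<alpha>e \<and> free_of \<alpha>e \<pi>1 \<and> free_of \<alpha>f \<pi>1"
    then obtain \<pi>1 \<pi>2 v e v' \<pi>3 where *: "is_concat suf \<pi>1 \<pi>2" "is_concat \<pi>2 (Fin v [(v, e, v')]) \<pi>3"
      "e \<in> \<alpha>e" "free_of \<alpha>f \<pi>1" by blast
    then obtain s1 vs where \<pi>1: "\<pi>1 = Fin s1 vs" by (cases \<pi>1) (auto simp: is_concat_def)
    have \<pi>2: "\<pi>2 = pappend (Fin v [(v, e, v')]) \<pi>3" "first \<pi>3 = endpoint v [(v, e, v')]"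
      using *(2) by (auto simp: is_concat_def)
    have suf: "suf = pappend (Fin s1 vs) \<pi>2" "first \<pi>2 = endpoint s1 vs"
      using *(1) \<pi>1 by (auto simp: is_concat_def)
    with \<pi>(2) have s1: "s1 = ?s1" by simp
    have v: "v = endpoint ?s1 vs" using suf(2) \<pi>2(1) s1 by simp
    have "walk M ?s1 vs" "fair_run M B \<pi>2"
      using run' suf s1 by (auto simp: fair_run_pappend[OF M])
    \<comment> \<open>The one-step path carrying the event is a prefix of a fair run and hence a
      walk, which shows that \<open>e\<close> is enabled in \<open>v\<close>.\<close>
    moreover from this(2) have "(v, e, v') \<in> transitions M"
      using fair_run_pappend[OF M \<pi>2(2)] \<pi>2(1) by simp
    then have "target M B \<alpha>f \<alpha>e (endpoint ?s1 vs)"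
      using *(3) finite_lts_step(1)[OF M] v unfolding target_def enabled_def by blast
    moreover have "\<forall>t\<in>set vs. lab t \<notin> \<alpha>f" using *(4) \<pi>1 by (auto simp: free_of_def)
    ultimately show ?thesis by blast
  qed
  with us pre(2) \<pi>(1) show ?thesis by auto
qed

text \<open>The outer diamond yields a walk into a \<open>target\<close> state that splits into a
  part matching \<open>\<rho>\<close> and an \<open>\<alpha>f\<close>-free part; the two preceding
  lemmas exchange such walks for violating fair runs.\<close>

theorem theorem28:
  fixes M :: "('s, 'a) lts"
    and B \<alpha>f \<alpha>e :: "'a set"
    and \<rho> :: "'a regular"
    and X W :: nat
  assumes "finite_lts M"
    and "B \<subseteq> acts M"
    and "regular_acts \<rho> \<subseteq> acts M"
    and "\<alpha>f \<subseteq> acts M"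
    and "\<alpha>e \<subseteq> acts M"
    and "X \<noteq> W"
  shows "M satisfies
      Neg (Dia (Seq \<rho> (Star (Acts (acts M - \<alpha>f))))
        (Or (Dia (Acts \<alpha>e) TT)
        (Or (Box (Acts (acts M - B)) FF)
            (BigOr {F. F \<noteq> {} \<and> F \<subseteq> acts M - B} (\<lambda>F.
               Nu X (BigAnd F (\<lambda>a.
                 Mu W (And (BigAnd ((acts M - B) - F) (\<lambda>b. Box (Acts {b}) FF))
                           (Or (Dia (Acts ({a} - \<alpha>f)) (Var X))
                               (Dia (Acts (acts M - \<alpha>f)) (Var W)))))))))))
    \<longleftrightarrow> \<not> (\<exists>\<pi>. is_path M \<pi> \<and> first \<pi> = initial M \<and>
             progressing M B \<pi> \<and> strongly_fair M B \<pi> \<and> violating \<rho> \<alpha>f \<alpha>e \<pi>)"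
proof -
  note M = assms(1)
  let ?\<phi> = "Or (Dia (Acts \<alpha>e) TT)
        (Or (Box (Acts (acts M - B)) FF)
            (BigOr {F. F \<noteq> {} \<and> F \<subseteq> acts M - B} (\<lambda>F.
               Nu X (BigAnd F (\<lambda>a.
                 Mu W (And (BigAnd ((acts M - B) - F) (\<lambda>b. Box (Acts {b}) FF))
                           (Or (Dia (Acts ({a} - \<alpha>f)) (Var X))
                               (Dia (Acts (acts M - \<alpha>f)) (Var W)))))))))"
  let ?R = "Seq \<rho> (Star (Acts (acts M - \<alpha>f)))"
  let ?s = "initial M"
  note goal = sem_target[OF M assms(5,6), of "\<lambda>_. {}" B \<alpha>f]
  have fin: "finite (regular_acts ?R)"
    using M assms(3) by (auto simp: finite_lts_def intro: finite_subset)
  have sub: "sem M (\<lambda>_. {}) ?\<phi> \<subseteq> states M"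
    unfolding goal by (auto simp: target_def)
  have "?s \<in> sem M (\<lambda>_. {}) (Dia ?R ?\<phi>) \<longleftrightarrow>
      (\<exists>ts. walk M ?s ts \<and> map lab ts \<in> lang ?R \<and> target M B \<alpha>f \<alpha>e (endpoint ?s ts))"
    unfolding sem_Dia[OF M fin sub] goal mem_Collect_eq ..
  also have "\<dots> \<longleftrightarrow> (\<exists>us vs. walk M ?s us \<and> map lab us \<in> lang \<rho> \<and> walk M (endpoint ?s us) vs \<and>
      (\<forall>t\<in>set vs. lab t \<notin> \<alpha>f) \<and> target M B \<alpha>f \<alpha>e (endpoint (endpoint ?s us) vs))"
    (is "?l \<longleftrightarrow> ?r")
  proof
    assume ?l
    then obtain ts u v where ts: "walk M ?s ts" "map lab ts = u @ v" "u \<in> lang \<rho>" "set v \<subseteq> acts M - \<alpha>f"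
      "target M B \<alpha>f \<alpha>e (endpoint ?s ts)"
      unfolding lang.simps(3) lang_Star_Acts lists_eq_set by blast
    then obtain us vs where "ts = us @ vs" "map lab us = u" "map lab vs = v"
      by (auto simp: map_eq_append_conv)
    with ts have "walk M ?s us" "map lab us \<in> lang \<rho>" "walk M (endpoint ?s us) vs"
      "\<forall>t\<in>set vs. lab t \<notin> \<alpha>f" "target M B \<alpha>f \<alpha>e (endpoint (endpoint ?s us) vs)"
      by (auto simp: walk_append[OF M] image_subset_iff)
    then show ?r by blast
  next
    assume ?r
    then obtain us vs where *: "walk M ?s us" "map lab us \<in> lang \<rho>" "walk M (endpoint ?s us) vs"
      "\<forall>t\<in>set vs. lab t \<notin> \<alpha>f" "target M B \<alpha>f \<alpha>e (endpoint (endpoint ?s us) vs)" by blast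
    \<comment> \<open>Labels on a walk lie in \<open>acts M\<close>, so avoiding
      \<open>\<alpha>f\<close> amounts to matching the starred complement.\<close>
    have "map lab vs \<in> lists (acts M - \<alpha>f)"
      using *(4) walk_transitions[OF *(3)] finite_lts_trans(2)[OF M] by (auto simp: lists_eq_set)
    with *(2) have "map lab (us @ vs) \<in> lang ?R"
      unfolding lang.simps(3) lang_Star_Acts by auto
    with * show ?l by (intro exI[of _ "us @ vs"]) (simp add: walk_append[OF M] del: lang.simps)
  qed
  also have "\<dots> \<longleftrightarrow> (\<exists>\<pi>. first \<pi> = ?s \<and> fair_run M B \<pi> \<and> violating \<rho> \<alpha>f \<alpha>e \<pi>)"
    using target_imp_run[OF M] run_imp_target[OF M] by metis
  finally have "?s \<in> sem M (\<lambda>_. {}) (Dia ?R ?\<phi>) \<longleftrightarrow>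
      (\<exists>\<pi>. first \<pi> = ?s \<and> fair_run M B \<pi> \<and> violating \<rho> \<alpha>f \<alpha>e \<pi>)" .
  moreover have "?s \<in> states M" using M by (simp add: finite_lts_def)
  ultimately show ?thesis
    unfolding satisfies_def sem.simps(3) fair_run_def Diff_iff by blast
qed

end
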